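(* Let $m\in\mathbb{N}$, $(\beta_0,\dots,\beta_m)\in D_m$, $x\in[0,\frac{m}{\beta_m-1}]$ and let $w\in\{0,\dots,m\}^{\mathbb{N}}$ be a $(\beta_0,\dots,\beta_m)$-expansion of $x$. Here $n$ ranges over $\mathbb{N}$. (1) (i) Suppose $\beta_0\le\beta_1\le\cdots\le\beta_m$. If $w$ is the greedy expansion of $x$, then $\sigma^nw\prec g^*(1)$ whenever $w_n<m$. (ii) Suppose $\beta_0\ge\beta_1\ge\cdots\ge\beta_m$. If $\sigma^nw\prec g^*(1)$ whenever $w_n<m$, then $w$ is the greedy expansion of $x$. (2) (i) Suppose $\beta_0\le\beta_1\le\cdots\le\beta_m$. If $w$ is the lazy expansion of $x$, then $\sigma^nw\succ l^*(\frac{m}{\beta_m-1}-1)$ whenever $w_n>0$. (ii) Suppose $\beta_0\ge\beta_1\ge\cdots\ge\beta_m$. If $\sigma^nw\succ l^*(\frac{m}{\beta_m-1}-1)$ whenever $w_n>0$, then $w$ is the lazy expansion of $x$. (3) (i) Suppose $\beta_0\le\beta_1\le\cdots\le\beta_m$. If $w$ is the unique expansion of $x$, then $\sigma^nw\prec g^*(1)$ whenever $w_n<m$, and $\sigma^nw\succ l^*(\frac{m}{\beta_m-1}-1)$ whenever $w_n>0$. (ii) Suppose $\beta_0\ge\beta_1\ge\cdots\ge\beta_m$. If $\sigma^nw\prec g^*(1)$ whenever $w_n<m$, and $\sigma^nw\succ l^*(\frac{m}{\beta_m-1}-1)$ whenever $w_n>0$, then $w$ is the unique expansion of $x$.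
   Context: $\mathbb{N}=\{1,2,3,\dots\}$. For $m\in\mathbb{N}$ and real $\beta_0,\dots,\beta_m>1$ put $a_k:=\frac{k}{\beta_k}$, $b_k:=\frac{k}{\beta_k}+\frac{m}{\beta_k(\beta_m-1)}$ and $T_k(x):=\beta_kx-k$ ($x\in\mathbb{R}$) for $k\in\{0,\dots,m\}$; so $a_0=0$, $b_m=\frac{m}{\beta_m-1}$. Define $D_m:=\{(\beta_0,\dots,\beta_m):\beta_0,\dots,\beta_m>1\text{ and }a_k<a_{k+1}\le b_k<b_{k+1}\text{ for all }0\le k\le m-1\}$. A sequence $w\in\{0,\dots,m\}^{\mathbb{N}}$ is a $(\beta_0,\dots,\beta_m)$-expansion of $x\in\mathbb{R}$ if $x=\sum_{i=1}^\infty\frac{w_i}{\beta_{w_1}\cdots\beta_{w_i}}$. It is the unique expansion of $x$ if it is the only $(\beta_0,\dots,\beta_m)$-expansion of $x$. The shift is $\sigma(w_1w_2\cdots)=w_2w_3\cdots$, and $\prec,\succ$ denote strict lexicographic order. Let $(\beta_0,\dots,\beta_m)\in D_m$. Define self-maps of $[0,\frac{m}{\beta_m-1}]$ by applying $T_k$ on the $k$-th piece of the following partitions of $[0,\frac{m}{\beta_m-1}]$ ($k=0,\dots,m$): - greedy $G$: pieces $[a_k,a_{k+1})$ for $0\le k\le m-1$, and $[a_m,b_m]$ for $k=m$; - quasi-greedy $G^*$: pieces $[0,a_1]$ for $k=0$, $(a_k,a_{k+1}]$ for $1\le k\le m-1$, and $(a_m,b_m]$ for $k=m$; - lazy $L$: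 pieces $[0,b_0]$ for $k=0$, and $(b_{k-1},b_k]$ for $1\le k\le m$; - quasi-lazy $L^*$: pieces $[0,b_0)$ for $k=0$, $[b_{k-1},b_k)$ for $1\le k\le m-1$, and $[b_{m-1},b_m]$ for $k=m$. For $x\in[0,\frac{m}{\beta_m-1}]$ the greedy expansion $g(x)=(g_n(x))_{n\ge1}$ has $g_n(x)=k$ where $G^{n-1}x$ lies in the $k$-th piece for $G$; the quasi-greedy expansion $g^*(x)$, lazy expansion $l(x)$ and quasi-lazy expansion $l^*(x)$ are defined in the same way from $G^*$, $L$, $L^*$ and their pieces.
   Formalization: When 1 > m/(β_m−1) (possible in parts (i), e.g. m=1, β=(1.1,5)), g^*(1) and l^*(m/(β_m−1)−1) are undefined as stated; there they are read as m^∞ and 0^∞, by using digit m above the interval and digit 0 below it. All other cases are as stated. *)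

theory Defs
  imports Complex_Main "HOL-Library.Fun_Lexorder"
begin

(* Sequences indexed by 1,2,3,... are functions on nat starting at 0: the i-th term of w is
   w (i - 1).  A tuple of bases (beta_0, ..., beta_m) is a function beta on nat; the values
   beta k with k > m are never used. *)

definition apt :: "(nat \<Rightarrow> real) \<Rightarrow> nat \<Rightarrow> real" where
  "apt \<beta> k = real k / \<beta> k"

definition bpt :: "nat \<Rightarrow> (nat \<Rightarrow> real) \<Rightarrow> nat \<Rightarrow> real" where
  "bpt m \<beta> k = real k / \<beta> k + real m / (\<beta> k * (\<beta> m - 1))"

definition T :: "(nat \<Rightarrow> real) \<Rightarrow> nat \<Rightarrow> real \<Rightarrow> real" where
  "T \<beta> k x = \<beta> k * x - real k"

definition D :: "nat \<Rightarrow> (nat \<Rightarrow> real) set" where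
  "D m = {\<beta>. (\<forall>k\<le>m. \<beta> k > 1) \<and>
              (\<forall>k<m. apt \<beta> k < apt \<beta> (k+1) \<and> apt \<beta> (k+1) \<le> bpt m \<beta> k \<and>
                     bpt m \<beta> k < bpt m \<beta> (k+1))}"

definition is_expansion :: "nat \<Rightarrow> (nat \<Rightarrow> real) \<Rightarrow> (nat \<Rightarrow> nat) \<Rightarrow> real \<Rightarrow> bool" where
  "is_expansion m \<beta> w x \<longleftrightarrow>
     (\<forall>i. w i \<le> m) \<and> (\<lambda>i. real (w i) / (\<Prod>j\<le>i. \<beta> (w j))) sums x"

definition is_unique_expansion :: "nat \<Rightarrow> (nat \<Rightarrow> real) \<Rightarrow> (nat \<Rightarrow> nat) \<Rightarrow> real \<Rightarrow> bool" where
  "is_unique_expansion m \<beta> w x \<longleftrightarrow>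
     is_expansion m \<beta> w x \<and> (\<forall>v. is_expansion m \<beta> v x \<longrightarrow> v = w)"

definition shift :: "nat \<Rightarrow> (nat \<Rightarrow> 'a) \<Rightarrow> nat \<Rightarrow> 'a" where
  "shift n w = (\<lambda>i. w (i + n))"

definition greedy_piece :: "nat \<Rightarrow> (nat \<Rightarrow> real) \<Rightarrow> nat \<Rightarrow> real set" where
  "greedy_piece m \<beta> k =
     (if k < m then {apt \<beta> k ..< apt \<beta> (k+1)} else {apt \<beta> m .. bpt m \<beta> m})"

definition quasi_greedy_piece :: "nat \<Rightarrow> (nat \<Rightarrow> real) \<Rightarrow> nat \<Rightarrow> real set" where
  "quasi_greedy_piece m \<beta> k =
     (if k = 0 then {0 .. apt \<beta> 1}
      else if k < m then {apt \<beta> k <.. apt \<beta> (k+1)}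
      else {apt \<beta> m <.. bpt m \<beta> m})"

definition lazy_piece :: "nat \<Rightarrow> (nat \<Rightarrow> real) \<Rightarrow> nat \<Rightarrow> real set" where
  "lazy_piece m \<beta> k =
     (if k = 0 then {0 .. bpt m \<beta> 0} else {bpt m \<beta> (k-1) <.. bpt m \<beta> k})"

definition quasi_lazy_piece :: "nat \<Rightarrow> (nat \<Rightarrow> real) \<Rightarrow> nat \<Rightarrow> real set" where
  "quasi_lazy_piece m \<beta> k =
     (if k = 0 then {0 ..< bpt m \<beta> 0}
      else if k < m then {bpt m \<beta> (k-1) ..< bpt m \<beta> k}
      else {bpt m \<beta> (m-1) .. bpt m \<beta> m})"

(* On [0, m/(beta_m - 1)] the digit of x is the index of the piece P k containing x.
   For beta in D m the number 1 need not lie in this interval (m = 1, beta_0 = 11/10, beta_1 = 5),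
   and m/(beta_m - 1) - 1 is then negative.  So that the expansions of these two numbers are always
   defined, the outermost pieces are prolonged: digit 0 to the left of the interval, digit m to its
   right.  Such points move away from the interval under T, so their expansions are constantly 0
   and constantly m, respectively. *)
definition digit :: "nat \<Rightarrow> (nat \<Rightarrow> real) \<Rightarrow> (nat \<Rightarrow> real set) \<Rightarrow> real \<Rightarrow> nat" where
  "digit m \<beta> P x =
     (if x < 0 then 0
      else if x > real m / (\<beta> m - 1) then m
      else (THE k. k \<le> m \<and> x \<in> P k))"

definition piecewise_map :: "nat \<Rightarrow> (nat \<Rightarrow> real) \<Rightarrow> (nat \<Rightarrow> real set) \<Rightarrow> real \<Rightarrow> real" where
  "piecewise_map m \<beta> P x = T \<beta> (digit m \<beta> P x) x"

definition digit_sequence ::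
    "nat \<Rightarrow> (nat \<Rightarrow> real) \<Rightarrow> (nat \<Rightarrow> real set) \<Rightarrow> real \<Rightarrow> nat \<Rightarrow> nat" where
  "digit_sequence m \<beta> P x = (\<lambda>n. digit m \<beta> P ((piecewise_map m \<beta> P ^^ n) x))"

definition greedy :: "nat \<Rightarrow> (nat \<Rightarrow> real) \<Rightarrow> real \<Rightarrow> nat \<Rightarrow> nat" where
  "greedy m \<beta> = digit_sequence m \<beta> (greedy_piece m \<beta>)"

definition quasi_greedy :: "nat \<Rightarrow> (nat \<Rightarrow> real) \<Rightarrow> real \<Rightarrow> nat \<Rightarrow> nat" where
  "quasi_greedy m \<beta> = digit_sequence m \<beta> (quasi_greedy_piece m \<beta>)"

definition lazy :: "nat \<Rightarrow> (nat \<Rightarrow> real) \<Rightarrow> real \<Rightarrow> nat \<Rightarrow> nat" where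
  "lazy m \<beta> = digit_sequence m \<beta> (lazy_piece m \<beta>)"

definition quasi_lazy :: "nat \<Rightarrow> (nat \<Rightarrow> real) \<Rightarrow> real \<Rightarrow> nat \<Rightarrow> nat" where
  "quasi_lazy m \<beta> = digit_sequence m \<beta> (quasi_lazy_piece m \<beta>)"

(* w (n - 1) is the n-th digit of w, and less_fun is the strict lexicographic order. *)
definition upper_condition :: "nat \<Rightarrow> (nat \<Rightarrow> real) \<Rightarrow> (nat \<Rightarrow> nat) \<Rightarrow> bool" where
  "upper_condition m \<beta> w \<longleftrightarrow>
     (\<forall>n\<ge>1. w (n - 1) < m \<longrightarrow> less_fun (shift n w) (quasi_greedy m \<beta> 1))"

definition lower_condition :: "nat \<Rightarrow> (nat \<Rightarrow> real) \<Rightarrow> (nat \<Rightarrow> nat) \<Rightarrow> bool" where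
  "lower_condition m \<beta> w \<longleftrightarrow>
     (\<forall>n\<ge>1. w (n - 1) > 0 \<longrightarrow> less_fun (quasi_lazy m \<beta> (real m / (\<beta> m - 1) - 1)) (shift n w))"

end

theory Submission
  imports Defs
begin

text \<open>
  A digit sequence \<open>w\<close> is an expansion of \<open>x\<close> exactly when applying the branches \<open>T (w 0)\<close>,
  \<open>T (w 1)\<close> and so on to \<open>x\<close> never leaves the interval \<open>[0, M]\<close>, where \<open>M = m / (\<beta> m - 1)\<close>
  (\<open>is_expansion_iff_itinerary\<close>). So everything is a statement about orbits of expanding affine
  maps, and the greedy expansion is the one whose orbit is below \<open>a (k+1)\<close> whenever its digit \<open>k\<close>
  is less than \<open>m\<close>.

  For a digit \<open>k < m\<close> this means that the next orbit point is below the image of \<open>a (k+1)\<close> under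
  the branch \<open>k\<close>, which is \<open>\<beta> k * (k+1) / \<beta> (k+1) - k\<close>. This number is at most 1 if the bases
  increase and at least 1 if they decrease; that comparison is the only use of monotonicity
  (\<open>branch_at_threshold_mono\<close>, \<open>branch_at_threshold_antimono\<close>). It remains to relate the inequality
  \<open>y < 1\<close> for an orbit point to the lexicographic comparison of its digits with the quasi-greedy
  digits of 1.

  If \<open>y < 1\<close>, the two orbits move apart under equal digits, so the digits differ somewhere, and at
  the first difference the smaller point has the smaller digit (\<open>greedy_less_quasi_greedy\<close>).
  Conversely, suppose that the digits of an orbit point \<open>y \<ge> 1\<close> are lexicographically smaller than
  those of 1. At the first difference the point carries a digit \<open>d\<close> but lies above \<open>a (d+1)\<close>, so the
  next orbit point again exceeds 1, by at least \<open>\<beta> d\<close> times the earlier excess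
  (\<open>overshoot_grows\<close>); the hypothesis applies to it too, and the excesses grow beyond all bounds,
  contradicting that the orbit stays in \<open>[0, M]\<close>.

  The lazy statements follow from the same argument after the reflection \<open>x \<mapsto> - x\<close>, \<open>k \<mapsto> m - k\<close>.
  It turns the tuple of bases into a system on \<open>[- M, 0]\<close> whose offsets are not given by the same
  formula, since \<open>0\<close> and \<open>M\<close> are fixed by branches of different slopes. The argument is therefore
  carried out for arbitrary affine branches. Finally, the greedy expansion is the lexicographically
  largest one and the lazy expansion the smallest, so an expansion is unique if and only if it is
  both greedy and lazy.
\<close>

section \<open>Sequences\<close>

lemma first_difference:
  fixes f g :: "nat \<Rightarrow> 'a"
  assumes "f \<noteq> g"
  obtains n where "f n \<noteq> g n" "\<forall>i<n. f i = g i"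
proof -
  have "\<exists>n. f n \<noteq> g n" using assms by auto
  then have "f (LEAST n. f n \<noteq> g n) \<noteq> g (LEAST n. f n \<noteq> g n)" by (rule LeastI_ex)
  moreover have "\<forall>i<(LEAST n. f n \<noteq> g n). f i = g i" using not_less_Least by blast
  ultimately show ?thesis by (rule that)
qed

lemma less_fun_complement:
  fixes f g :: "nat \<Rightarrow> nat"
  assumes "\<And>i. f i \<le> m" "\<And>i. g i \<le> m"
  shows "less_fun (\<lambda>i. m - f i) (\<lambda>i. m - g i) \<longleftrightarrow> less_fun g f"
proof -
  have "m - f i < m - g i \<longleftrightarrow> g i < f i" "m - f i = m - g i \<longleftrightarrow> g i = f i" for i
    using assms[of i] by auto
  then show ?thesis by (simp add: less_fun_def)
qed

lemma complement_inject:
  fixes f g :: "nat \<Rightarrow> nat"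
  assumes "\<And>i. f i \<le> m" "\<And>i. g i \<le> m" "(\<lambda>i. m - f i) = (\<lambda>i. m - g i)"
  shows "f = g"
proof
  fix i
  have "m - f i = m - g i" using assms(3) by (rule fun_cong)
  then show "f i = g i" using assms(1,2)[of i] by simp
qed

lemma all_ge_1_iff: "(\<forall>n\<ge>1. P n) \<longleftrightarrow> (\<forall>n. P (Suc n))" for P :: "nat \<Rightarrow> bool"
  by (auto simp: Suc_le_eq gr0_conv_Suc)

section \<open>Itineraries under expanding affine branches\<close>

text \<open>The branches are \<open>x \<mapsto> \<beta> k * x - c k\<close>, and \<open>(p + c k) / \<beta> k\<close> is the preimage of the left end \<open>p\<close>
under the branch \<open>k\<close>. With arbitrary offsets \<open>c\<close> the assumptions hold for the branches
\<open>T \<beta> k\<close> on \<open>[0, M]\<close> as well as for their reflection on \<open>[- M, 0]\<close>.\<close>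

locale expanding_branches =
  fixes m :: nat and \<beta> c :: "nat \<Rightarrow> real" and p q :: real
  assumes expanding: "k \<le> m \<Longrightarrow> 1 < \<beta> k"
    and left_step: "k < m \<Longrightarrow> (p + c k) / \<beta> k < (p + c (Suc k)) / \<beta> (Suc k)"
begin

definition branch :: "nat \<Rightarrow> real \<Rightarrow> real" where
  "branch k x = \<beta> k * x - c k"

definition left :: "nat \<Rightarrow> real" where
  "left k = (p + c k) / \<beta> k"

primrec orbit :: "(nat \<Rightarrow> nat) \<Rightarrow> real \<Rightarrow> nat \<Rightarrow> real" where
  "orbit w x 0 = x"
| "orbit w x (Suc n) = branch (w n) (orbit w x n)"

definition itinerary :: "(nat \<Rightarrow> nat) \<Rightarrow> real \<Rightarrow> bool" where
  "itinerary w x \<longleftrightarrow> (\<forall>n. w n \<le> m \<and> orbit w x n \<in> {p..q})"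

text \<open>An orbit point with digit \<open>k\<close> is automatically at least \<open>left k\<close>, since its image is at least \<open>p\<close>.
Being greedy is thus only a condition from above, whereas the quasi-greedy pieces, which except
for the first are open on the left, also need the strict lower bound.\<close>

definition greedy_itinerary :: "(nat \<Rightarrow> nat) \<Rightarrow> real \<Rightarrow> bool" where
  "greedy_itinerary w x \<longleftrightarrow>
     itinerary w x \<and> (\<forall>n. w n < m \<longrightarrow> orbit w x n < left (Suc (w n)))"

definition quasi_greedy_itinerary :: "(nat \<Rightarrow> nat) \<Rightarrow> real \<Rightarrow> bool" where
  "quasi_greedy_itinerary w x \<longleftrightarrow> itinerary w x \<and>
     (\<forall>n. (w n < m \<longrightarrow> orbit w x n \<le> left (Suc (w n))) \<and> (0 < w n \<longrightarrow> left (w n) < orbit w x n))"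

lemma itineraryD:
  assumes "itinerary w x"
  shows "w n \<le> m" "p \<le> orbit w x n" "orbit w x n \<le> q"
  using assms by (auto simp: itinerary_def)

lemma left_strict_mono:
  assumes "i < j" "j \<le> m"
  shows "left i < left j"
  using assms
proof (induction j)
  case (Suc j)
  have "left j < left (Suc j)" using left_step[of j] Suc.prems by (simp add: left_def)
  then show ?case using Suc by (cases "i = j") auto
qed simp

lemma left_mono: "i \<le> j \<Longrightarrow> j \<le> m \<Longrightarrow> left i \<le> left j"
  using left_strict_mono[of i j] by (cases "i = j") auto

lemma branch_diff: "branch k y - branch k x = \<beta> k * (y - x)"
  by (simp add: branch_def algebra_simps)

lemma left_le_iff: "k \<le> m \<Longrightarrow> left k \<le> x \<longleftrightarrow> p \<le> branch k x"
  using expanding[of k] by (auto simp: left_def branch_def field_simps)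

lemma orbit_cong: "\<forall>i<n. v i = w i \<Longrightarrow> orbit v x n = orbit w x n"
  by (induction n) auto

lemma orbit_shift: "orbit (shift n w) (orbit w x n) i = orbit w x (i + n)"
  by (induction i) (auto simp: shift_def)

lemma itinerary_shift: "itinerary w x \<Longrightarrow> itinerary (shift n w) (orbit w x n)"
  by (simp add: itinerary_def orbit_shift) (simp add: shift_def)

lemma greedy_itinerary_shift:
  "greedy_itinerary w x \<Longrightarrow> greedy_itinerary (shift n w) (orbit w x n)"
  by (simp add: greedy_itinerary_def itinerary_shift orbit_shift) (simp add: shift_def)

text \<open>Two points that are moved by the same digits separate by the product of the slopes. In an
interval of bounded length this cannot go on forever.\<close>

lemma orbit_diff: "orbit w y n - orbit w x n = (\<Prod>i<n. \<beta> (w i)) * (y - x)"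
  by (induction n) (simp_all add: branch_diff)

text \<open>Finitely many slopes have a common lower bound above 1, which makes the growth geometric.\<close>

lemma expansion_rate:
  obtains r where "1 < r" "\<forall>k\<le>m. r \<le> \<beta> k"
proof
  have "Min (\<beta> ` {..m}) \<in> \<beta> ` {..m}" by (rule Min_in) auto
  then show "1 < Min (\<beta> ` {..m})" using expanding by auto
qed auto

lemma prod_ge_power:
  assumes "1 < r" "\<forall>k\<le>m. r \<le> \<beta> k" "\<And>i. w i \<le> m"
  shows "r ^ n \<le> (\<Prod>i<n. \<beta> (w i))"
  using prod_mono[of "{..<n}" "\<lambda>_. r" "\<lambda>i. \<beta> (w i)"] assms by simp

lemma prod_bases_ge_1: "(\<And>i. w i \<le> m) \<Longrightarrow> 1 \<le> (\<Prod>i<n. \<beta> (w i))"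
  by (rule prod_ge_1) (simp add: expanding less_imp_le)

lemma inverse_prod_tendsto_0:
  assumes "\<And>i. w i \<le> m"
  shows "(\<lambda>n. 1 / (\<Prod>i<n. \<beta> (w i))) \<longlonglongrightarrow> 0"
proof -
  obtain r where r: "1 < r" "\<forall>k\<le>m. r \<le> \<beta> k" by (rule expansion_rate)
  have lim: "(\<lambda>n. inverse r ^ n) \<longlonglongrightarrow> 0"
    using r(1) by (intro LIMSEQ_realpow_zero) (auto simp: field_simps)
  have le: "1 / (\<Prod>i<n. \<beta> (w i)) \<le> inverse r ^ n" for n
    using prod_ge_power[of r w n] assms r le_imp_inverse_le[of "r ^ n"]
    by (simp add: power_inverse inverse_eq_divide power_one_over)
  have ge: "0 \<le> 1 / (\<Prod>i<n. \<beta> (w i))" for n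
    using prod_bases_ge_1[of w n] assms by simp
  show ?thesis
    by (intro tendsto_sandwich[OF always_eventually always_eventually tendsto_const lim]) (use le ge in auto)
qed

lemma itinerary_determines_point:
  assumes "itinerary w x" "itinerary w y"
  shows "x = y"
proof -
  have w: "w i \<le> m" for i using assms(1) by (rule itineraryD)
  define P where "P n = (\<Prod>i<n. \<beta> (w i))" for n
  have P: "1 \<le> P n" for n unfolding P_def by (rule prod_bases_ge_1[OF w])
  have "\<bar>y - x\<bar> \<le> (q - p) * (1 / P n)" for n
  proof -
    have "P n * \<bar>y - x\<bar> = \<bar>orbit w y n - orbit w x n\<bar>"
      using P[of n] by (simp add: orbit_diff P_def abs_mult)
    also have "\<dots> \<le> q - p"
      using itineraryD[OF assms(1), of n] itineraryD[OF assms(2), of n] by linarith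
    finally show ?thesis using P[of n] by (simp add: field_simps)
  qed
  moreover have "(\<lambda>n. (q - p) * (1 / P n)) \<longlonglongrightarrow> (q - p) * 0"
    unfolding P_def by (rule tendsto_mult_left[OF inverse_prod_tendsto_0[OF w]])
  ultimately have "\<bar>y - x\<bar> \<le> (q - p) * 0"
    by (intro LIMSEQ_le_const) auto
  then show ?thesis by simp
qed

text \<open>At the first place where another itinerary of the same point differs, both orbits are at the same
point \<open>y\<close>. This point is below \<open>left (k + 1)\<close> for the greedy digit \<open>k\<close>, and at least \<open>left j\<close> for
any digit \<open>j\<close> that keeps the orbit in the interval; hence \<open>j \<le> k\<close>.\<close>

lemma greedy_itinerary_greatest:
  assumes "greedy_itinerary w x" "itinerary v x"
  shows "v = w \<or> less_fun v w"
proof (cases "v = w")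
  case False
  then obtain n where n: "v n \<noteq> w n" "\<forall>i<n. v i = w i"
    by (rule first_difference)
  have eq: "orbit v x n = orbit w x n" using n(2) by (rule orbit_cong)
  have "v n \<le> w n"
  proof (rule ccontr)
    assume gt: "\<not> v n \<le> w n"
    have "v n \<le> m" using assms(2) by (rule itineraryD)
    then have "orbit w x n < left (Suc (w n))" "left (Suc (w n)) \<le> left (v n)"
      using assms(1) gt by (auto simp: greedy_itinerary_def intro!: left_mono)
    moreover have "left (v n) \<le> orbit v x n"
      using itineraryD(2)[OF assms(2), of "Suc n"] \<open>v n \<le> m\<close> by (simp add: left_le_iff)
    ultimately show False using eq by simp
  qed
  then have "v n < w n" using n(1) by simp
  then show ?thesis using n(2) by (blast intro: less_funI)
qed simp

lemma greedy_itinerary_unique: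
  assumes "greedy_itinerary v x" "greedy_itinerary w x"
  shows "v = w"
  using greedy_itinerary_greatest[of v x w] greedy_itinerary_greatest[of w x v] assms less_fun_asym
  by (metis greedy_itinerary_def)

text \<open>The digits cannot agree forever, because they would determine the point. At the first difference
the order \<open>y < z\<close> has been preserved by the equal branches. The half-open greedy pieces
\<open>[left k, left (k + 1))\<close> and quasi-greedy pieces \<open>(left j, left (j + 1)]\<close> then force the digits to
be in the same order, also when one of the points is an end of its piece.\<close>

lemma greedy_less_quasi_greedy:
  assumes "greedy_itinerary v y" "quasi_greedy_itinerary u z" "y < z"
  shows "less_fun v u"
proof -
  have v: "itinerary v y" and u: "itinerary u z"
    using assms by (auto simp: greedy_itinerary_def quasi_greedy_itinerary_def)
  have "v \<noteq> u" using itinerary_determines_point v u \<open>y < z\<close> by blast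
  then obtain n where n: "v n \<noteq> u n" "\<forall>i<n. v i = u i"
    by (rule first_difference)
  have "0 < orbit v z n - orbit v y n"
    unfolding orbit_diff using prod_bases_ge_1[of v n] itineraryD(1)[OF v] \<open>y < z\<close>
    by (intro mult_pos_pos) (auto intro: less_le_trans[of 0 1])
  moreover have "orbit v z n = orbit u z n" using n(2) by (rule orbit_cong)
  ultimately have lt: "orbit v y n < orbit u z n" by simp
  have "v n \<le> u n"
  proof (rule ccontr)
    assume gt: "\<not> v n \<le> u n"
    have "v n \<le> m" using v by (rule itineraryD)
    then have "orbit u z n \<le> left (Suc (u n))" "left (Suc (u n)) \<le> left (v n)"
      using assms(2) gt by (auto simp: quasi_greedy_itinerary_def intro!: left_mono)
    moreover have "left (v n) \<le> orbit v y n"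
      using itineraryD(2)[OF v, of "Suc n"] \<open>v n \<le> m\<close> by (simp add: left_le_iff)
    ultimately show False using lt by simp
  qed
  then have "v n < u n" using n(1) by simp
  then show ?thesis using n(2) by (blast intro: less_funI)
qed

text \<open>The bound on \<open>branch k (left (k + 1))\<close> says that a greedy digit \<open>k < m\<close> sends the orbit below \<open>z\<close>,
where the preceding comparison applies.\<close>

theorem greedy_imp_lexicographic:
  assumes "\<And>k. k < m \<Longrightarrow> branch k (left (Suc k)) \<le> z"
    and "quasi_greedy_itinerary u z" "greedy_itinerary w x" "w n < m"
  shows "less_fun (shift (Suc n) w) u"
proof (rule greedy_less_quasi_greedy[OF greedy_itinerary_shift[OF assms(3)] assms(2)])
  have "orbit w x n < left (Suc (w n))" using assms by (simp add: greedy_itinerary_def)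
  then have "branch (w n) (orbit w x n) < branch (w n) (left (Suc (w n)))"
    using expanding[of "w n"] \<open>w n < m\<close> by (simp add: branch_def)
  also have "\<dots> \<le> z" using assms by simp
  finally show "orbit w x (Suc n) < z" by simp
qed

text \<open>Let \<open>l\<close> be the position of the first difference. Up to there the orbits of \<open>orbit w x n\<close> and \<open>z\<close> are
moved by the same digits, so the distance between them does not shrink. The orbit of \<open>z\<close> is above
\<open>left (u j)\<close>, hence above \<open>left (w l + 1)\<close>, and the branch \<open>w l\<close> maps the latter point to at least
\<open>z\<close>. So the branch multiplies the excess over \<open>z\<close> by at least its slope.\<close>

lemma overshoot_grows:
  assumes far: "\<And>k. k < m \<Longrightarrow> z \<le> branch k (left (Suc k))"
    and u: "quasi_greedy_itinerary u z" and w: "itinerary w x"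
    and less: "less_fun (shift n w) u" and over: "z \<le> orbit w x n"
  obtains l where "w l < m" "\<beta> (w l) * (orbit w x n - z) < orbit w x (Suc l) - z"
proof -
  obtain j where j: "shift n w j < u j" "\<forall>i<j. shift n w i = u i"
    using less unfolding less_fun_def by blast
  have "u j \<le> m" using u by (auto simp: quasi_greedy_itinerary_def intro: itineraryD)
  define l where "l = j + n"
  have d: "w l < u j" using j(1) by (simp add: shift_def l_def)
  then have "w l < m" using \<open>u j \<le> m\<close> by simp
  have "left (Suc (w l)) \<le> left (u j)" using d \<open>u j \<le> m\<close> by (intro left_mono) auto
  also have "\<dots> < orbit u z j" using u d by (auto simp: quasi_greedy_itinerary_def)
  finally have "left (Suc (w l)) < orbit u z j" .
  moreover have "orbit (shift n w) (orbit w x n) j - orbit (shift n w) z j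
      = (\<Prod>i<j. \<beta> (shift n w i)) * (orbit w x n - z)"
    by (rule orbit_diff)
  moreover have "orbit (shift n w) z j = orbit u z j" using j(2) by (rule orbit_cong)
  moreover have "1 * (orbit w x n - z) \<le> (\<Prod>i<j. \<beta> (shift n w i)) * (orbit w x n - z)"
    using itineraryD(1)[OF w] over
    by (intro mult_right_mono prod_bases_ge_1) (auto simp: shift_def)
  ultimately have "orbit w x n - z < orbit w x l - left (Suc (w l))"
    by (simp add: orbit_shift l_def)
  then have "\<beta> (w l) * (orbit w x n - z) < \<beta> (w l) * (orbit w x l - left (Suc (w l)))"
    using expanding[of "w l"] \<open>w l < m\<close> by simp
  also have "\<dots> = orbit w x (Suc l) - branch (w l) (left (Suc (w l)))"
    by (simp add: branch_diff)
  also have "\<dots> \<le> orbit w x (Suc l) - z" using far[OF \<open>w l < m\<close>] by simp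
  finally show thesis using that \<open>w l < m\<close> by blast
qed

text \<open>The point produced by \<open>overshoot_grows\<close> comes directly after a digit below \<open>m\<close>, so its digits are
again lexicographically smaller than \<open>u\<close> and the lemma can be iterated. One orbit point at or above
\<open>z\<close> after a digit below \<open>m\<close> would therefore give orbit points arbitrarily far above \<open>z\<close>.\<close>

theorem lexicographic_imp_greedy:
  assumes far: "\<And>k. k < m \<Longrightarrow> z \<le> branch k (left (Suc k))"
    and u: "quasi_greedy_itinerary u z" and w: "itinerary w x"
    and less: "\<And>n. w n < m \<Longrightarrow> less_fun (shift (Suc n) w) u"
  shows "greedy_itinerary w x"
proof -
  obtain r where r: "1 < r" "\<forall>k\<le>m. r \<le> \<beta> k" by (rule expansion_rate)
  have below: "orbit w x (Suc n) < z" if "w n < m" for n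
  proof (rule ccontr)
    assume "\<not> orbit w x (Suc n) < z"
    then have over: "z \<le> orbit w x (Suc n)" by simp
    obtain l where l: "w l < m" "\<beta> (w l) * (orbit w x (Suc n) - z) < orbit w x (Suc l) - z"
      by (rule overshoot_grows[OF far u w less[OF \<open>w n < m\<close>] over])
    \<comment> \<open>The given excess over \<open>z\<close> may be zero; the next one is positive, so its multiples by \<open>r ^ i\<close> grow.\<close>
    define e where "e = orbit w x (Suc l) - z"
    have "0 \<le> \<beta> (w l) * (orbit w x (Suc n) - z)"
      using over expanding[of "w l"] l(1) by (intro mult_nonneg_nonneg) auto
    then have "0 < e" using l(2) by (simp add: e_def)
    have grow: "\<exists>k. w k < m \<and> r ^ i * e \<le> orbit w x (Suc k) - z" for i
    proof (induction i)
      case 0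
      show ?case using l(1) by (auto simp: e_def)
    next
      case (Suc i)
      then obtain k where k: "w k < m" "r ^ i * e \<le> orbit w x (Suc k) - z" by blast
      have "0 \<le> r ^ i * e" using \<open>0 < e\<close> r(1) by simp
      then have over: "z \<le> orbit w x (Suc k)" using k(2) by linarith
      obtain k' where k': "w k' < m"
          "\<beta> (w k') * (orbit w x (Suc k) - z) < orbit w x (Suc k') - z"
        by (rule overshoot_grows[OF far u w less[OF k(1)] over])
      have "r * (r ^ i * e) \<le> \<beta> (w k') * (orbit w x (Suc k) - z)"
        using k(2) r k'(1) \<open>0 \<le> r ^ i * e\<close> expanding[of "w k'"] by (intro mult_mono) auto
      then have "r ^ Suc i * e \<le> orbit w x (Suc k') - z" using k'(2) by simp
      then show ?case using k'(1) by blast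
    qed
    obtain i where "(q - z) / e < r ^ i" using real_arch_pow[OF r(1)] by blast
    then have "q - z < r ^ i * e" using \<open>0 < e\<close> by (simp add: field_simps)
    moreover obtain k where "r ^ i * e \<le> orbit w x (Suc k) - z" using grow by blast
    ultimately show False using itineraryD(3)[OF w, of "Suc k"] by linarith
  qed
  have "orbit w x n < left (Suc (w n))" if "w n < m" for n
  proof -
    have "branch (w n) (orbit w x n) < branch (w n) (left (Suc (w n)))"
      using below[OF that] far[OF that] by simp
    then show ?thesis using expanding[of "w n"] that by (simp add: branch_def)
  qed
  then show ?thesis using w by (simp add: greedy_itinerary_def)
qed

end

section \<open>The two systems of a tuple of bases\<close>

text \<open>The locale carries two instances of the general system: \<open>up\<close> for the given branches and \<open>down\<close> for
their reflection. The points \<open>apt \<beta> k\<close> are the thresholds of the first, the points \<open>- bpt m \<beta> k\<close>, in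
reversed order, those of the second.\<close>

locale base_tuple =
  fixes m :: nat and \<beta> :: "nat \<Rightarrow> real"
  assumes m_pos: "1 \<le> m" and bases: "\<beta> \<in> D m"
begin

definition M :: real where "M = real m / (\<beta> m - 1)"

lemma base_gt_1: "k \<le> m \<Longrightarrow> 1 < \<beta> k"
  and apt_step: "k < m \<Longrightarrow> apt \<beta> k < apt \<beta> (Suc k)"
  and apt_le_bpt: "k < m \<Longrightarrow> apt \<beta> (Suc k) \<le> bpt m \<beta> k"
  and bpt_step: "k < m \<Longrightarrow> bpt m \<beta> k < bpt m \<beta> (Suc k)"
  using bases by (auto simp: D_def)

lemma bpt_eq: "k \<le> m \<Longrightarrow> bpt m \<beta> k = (real k + M) / \<beta> k"
  by (simp add: bpt_def M_def add_divide_distrib mult.commute)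

lemma M_pos: "0 < M"
  using base_gt_1[of m] m_pos by (simp add: M_def)

lemma M_fixed: "\<beta> m * M - real m = M"
proof -
  have "\<beta> m * M - real m - M = (\<beta> m - 1) * M - real m"
    by (simp only: left_diff_distrib mult_1)
  also have "(\<beta> m - 1) * M = real m" using base_gt_1[of m] by (simp add: M_def)
  finally show ?thesis by simp
qed

lemma bpt_top: "bpt m \<beta> m = M"
proof -
  have "real m + M = M * \<beta> m" using M_fixed by (simp only: mult.commute[of M])
  then show ?thesis using base_gt_1[of m] by (simp only: bpt_eq) simp
qed

lemma bpt_le_M: "k \<le> m \<Longrightarrow> bpt m \<beta> k \<le> M"
proof (induction rule: inc_induct)
  case base
  then show ?case by (simp add: bpt_top)
next
  case (step k)
  then show ?case using bpt_step[of k] by simp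
qed

sublocale up: expanding_branches m \<beta> real 0 M
proof
  show "(0 + real k) / \<beta> k < (0 + real (Suc k)) / \<beta> (Suc k)" if "k < m" for k
    using apt_step[OF that] by (simp add: apt_def)
qed (rule base_gt_1)

lemma reflected_left:
  "(- M + - real (m - k)) / \<beta> (m - k) = - bpt m \<beta> (m - k)"
proof -
  have "- M + - real (m - k) = - (real (m - k) + M)" by linarith
  then show ?thesis by (simp only: bpt_eq[OF diff_le_self] minus_divide_left)
qed

sublocale down: expanding_branches m "\<lambda>k. \<beta> (m - k)" "\<lambda>k. - real (m - k)" "- M" 0
proof
  fix k assume "k < m"
  then have "bpt m \<beta> (m - Suc k) < bpt m \<beta> (m - k)"
    using bpt_step[of "m - Suc k"] by (simp add: Suc_diff_Suc)
  then show "(- M + - real (m - k)) / \<beta> (m - k)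
      < (- M + - real (m - Suc k)) / \<beta> (m - Suc k)"
    unfolding reflected_left by simp
qed (simp add: base_gt_1)

lemma up_left: "up.left k = apt \<beta> k"
  by (simp add: up.left_def apt_def)

lemma down_left: "down.left k = - bpt m \<beta> (m - k)"
  unfolding down.left_def by (rule reflected_left)

lemma up_branch: "up.branch k y = T \<beta> k y"
  by (simp add: up.branch_def T_def)

lemma down_orbit:
  assumes "\<And>i. w i \<le> m"
  shows "down.orbit (\<lambda>i. m - w i) (- x) n = - up.orbit w x n"
  by (induction n) (simp_all add: down.branch_def up.branch_def assms)

lemma down_itinerary:
  assumes "\<And>i. w i \<le> m"
  shows "down.itinerary (\<lambda>i. m - w i) (- x) \<longleftrightarrow> up.itinerary w x"
  unfolding down.itinerary_def up.itinerary_def by (auto simp: down_orbit[OF assms] assms)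

text \<open>If \<open>S n\<close> is the partial sum and \<open>P n\<close> the product of the first \<open>n\<close> bases, the orbit of any \<open>x\<close> is
\<open>P n * (x - S n)\<close>. An orbit in \<open>[0, M]\<close> means \<open>S n \<le> x \<le> S n + M / P n\<close> for all \<open>n\<close>, which forces
\<open>S n\<close> to converge to \<open>x\<close>. Conversely, \<open>S n\<close> increases, and \<open>S n + M / P n\<close> decreases because
\<open>(k + M) / \<beta> k = bpt m \<beta> k \<le> M\<close>; so a common limit \<open>x\<close> lies between them.\<close>

lemma is_expansion_iff_itinerary: "is_expansion m \<beta> w x \<longleftrightarrow> up.itinerary w x"
proof (cases "\<forall>i. w i \<le> m")
  case False
  then show ?thesis by (auto simp: is_expansion_def up.itinerary_def)
next
  case True
  then have w: "w i \<le> m" for i by blast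
  define t where "t i = real (w i) / (\<Prod>j\<le>i. \<beta> (w j))" for i
  define S where "S n = (\<Sum>i<n. t i)" for n
  define P where "P n = (\<Prod>i<n. \<beta> (w i))" for n
  have P: "0 < P n" for n
    unfolding P_def using up.prod_bases_ge_1[of w n] w by (simp add: less_le_trans[OF zero_less_one])
  have P_Suc: "P (Suc n) = P n * \<beta> (w n)" for n by (simp add: P_def)
  have S_Suc: "S (Suc n) = S n + real (w n) / P (Suc n)" for n
  proof -
    have "P (Suc n) = (\<Prod>j\<le>n. \<beta> (w j))" by (simp only: P_def lessThan_Suc_atMost)
    then show ?thesis by (simp add: S_def t_def)
  qed
  have orbit: "up.orbit w x n = P n * (x - S n)" for n
  proof (induction n)
    case 0
    show ?case by (simp add: P_def S_def)
  next
    case (Suc n)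
    have "up.orbit w x (Suc n) = P (Suc n) * (x - S n) - real (w n)"
      by (simp add: up.branch_def Suc.IH P_Suc)
    also have "\<dots> = P (Suc n) * (x - S (Suc n))"
      using P[of "Suc n"] by (simp add: S_Suc right_diff_distrib distrib_left)
    finally show ?case .
  qed
  have tail: "(\<lambda>n. M * (1 / P n)) \<longlonglongrightarrow> 0"
    unfolding P_def using tendsto_mult_left[OF up.inverse_prod_tendsto_0[of w], of M] w by simp
  have "is_expansion m \<beta> w x \<longleftrightarrow> S \<longlonglongrightarrow> x"
    using w by (simp add: is_expansion_def sums_def S_def[abs_def] t_def)
  also have "\<dots> \<longleftrightarrow> up.itinerary w x"
  proof
    assume lim: "S \<longlonglongrightarrow> x"
    have "incseq S"
      using P by (intro incseq_SucI) (simp add: S_Suc less_imp_le)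
    then have lower: "S n \<le> x" for n using lim by (rule incseq_le)
    have "decseq (\<lambda>n. S n + M * (1 / P n))"
    proof (rule decseq_SucI)
      fix n
      have "(real (w n) + M) / \<beta> (w n) \<le> M" using bpt_le_M[OF w] bpt_eq[OF w] by simp
      then have "((real (w n) + M) / \<beta> (w n)) / P n \<le> M / P n"
        using P[of n] by (intro divide_right_mono) auto
      then show "S (Suc n) + M * (1 / P (Suc n)) \<le> S n + M * (1 / P n)"
        by (simp add: S_Suc P_Suc add_divide_distrib mult.commute)
    qed
    moreover have "(\<lambda>n. S n + M * (1 / P n)) \<longlonglongrightarrow> x" using tendsto_add[OF lim tail] by simp
    ultimately have upper: "x \<le> S n + M * (1 / P n)" for n by (rule decseq_ge)
    have "up.orbit w x n \<in> {0..M}" for n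
    proof -
      have "P n * (x - S n) \<le> P n * (M * (1 / P n))"
        using upper[of n] P[of n] by (intro mult_left_mono) auto
      also have "\<dots> = M" using P[of n] by simp
      finally show ?thesis using lower[of n] P[of n] by (simp add: orbit)
    qed
    then show "up.itinerary w x" using w by (simp add: up.itinerary_def)
  next
    assume it: "up.itinerary w x"
    have "0 \<le> x - S n" "x - S n \<le> M * (1 / P n)" for n
    proof -
      show "0 \<le> x - S n"
        using up.itineraryD(2)[OF it, of n] P[of n] by (simp add: orbit zero_le_mult_iff)
      have "P n * (x - S n) \<le> M" using up.itineraryD(3)[OF it, of n] by (simp add: orbit)
      then show "x - S n \<le> M * (1 / P n)"
        using P[of n] by (simp add: pos_le_divide_eq mult.commute)
    qed
    then have "(\<lambda>n. x - S n) \<longlonglongrightarrow> 0"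
      by (intro tendsto_sandwich[OF always_eventually always_eventually tendsto_const tail]) auto
    from tendsto_diff[OF tendsto_const[of x] this] show "S \<longlonglongrightarrow> x" by simp
  qed
  finally show ?thesis .
qed

section \<open>Digit sequences of the four maps\<close>

text \<open>Each of the four partitions consists of the sets where a threshold condition \<open>R k\<close> holds for the
first time, with everything left over assigned to \<open>m\<close>.\<close>

lemma unique_first_index:
  fixes R :: "nat \<Rightarrow> bool"
  assumes mono: "\<And>k. Suc k < m \<Longrightarrow> R k \<Longrightarrow> R (Suc k)"
  shows "\<exists>!k. k \<le> m \<and> (k < m \<longrightarrow> R k) \<and> (0 < k \<longrightarrow> \<not> R (k - 1))"
proof (rule ex_ex1I)
  define k where "k = (LEAST k. k = m \<or> R k)"
  have "k = m \<or> R k" unfolding k_def by (rule LeastI[of _ m]) simp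
  moreover have "k \<le> m" unfolding k_def by (rule Least_le) simp
  moreover have "\<not> R (k - 1)" if "0 < k"
    using not_less_Least[of "k - 1" "\<lambda>k. k = m \<or> R k"] that unfolding k_def by simp
  ultimately show "\<exists>k. k \<le> m \<and> (k < m \<longrightarrow> R k) \<and> (0 < k \<longrightarrow> \<not> R (k - 1))" by blast
next
  have up: "R j" if "i \<le> j" "R i" "j < m" for i j
    using that
  proof (induction j rule: dec_induct)
    case (step j)
    then show ?case using mono[of j] by simp
  qed
  have "\<not> k < k'" if "k < m \<longrightarrow> R k" "k' \<le> m" "0 < k' \<longrightarrow> \<not> R (k' - 1)" for k k'
  proof
    assume "k < k'"
    then have "k \<le> k' - 1" "k' - 1 < m" "0 < k'" "k < m" using that(2) by auto
    then show False using up[of k "k' - 1"] that by blast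
  qed
  then show "k = k'"
    if "k \<le> m \<and> (k < m \<longrightarrow> R k) \<and> (0 < k \<longrightarrow> \<not> R (k - 1))"
       "k' \<le> m \<and> (k' < m \<longrightarrow> R k') \<and> (0 < k' \<longrightarrow> \<not> R (k' - 1))" for k k'
    using that by (meson linorder_neqE_nat)
qed

text \<open>A cut between the pieces \<open>k\<close> and \<open>k + 1\<close> keeps the map inside \<open>[0, M]\<close> if it lies in the overlap
\<open>[apt \<beta> (k + 1), bpt m \<beta> k]\<close> of the domains of both branches. All four maps are of this kind: they
cut at one end of the overlap, and differ in the side that the cut point itself belongs to.\<close>

lemma digit_sequence_itinerary:
  fixes R :: "nat \<Rightarrow> real \<Rightarrow> bool"
  assumes pieces: "\<And>k y. k \<le> m \<Longrightarrow> 0 \<le> y \<Longrightarrow> y \<le> M \<Longrightarrow>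
      y \<in> P k \<longleftrightarrow> (k < m \<longrightarrow> R k y) \<and> (0 < k \<longrightarrow> \<not> R (k - 1) y)"
    and mono: "\<And>k y. Suc k < m \<Longrightarrow> R k y \<Longrightarrow> R (Suc k) y"
    and le: "\<And>k y. k < m \<Longrightarrow> R k y \<Longrightarrow> y \<le> bpt m \<beta> k"
    and ge: "\<And>k y. k < m \<Longrightarrow> \<not> R k y \<Longrightarrow> apt \<beta> (Suc k) \<le> y"
    and x: "0 \<le> x" "x \<le> M"
  defines "w \<equiv> digit_sequence m \<beta> P x"
  shows "up.itinerary w x"
    and "\<And>n. w n < m \<Longrightarrow> R (w n) (up.orbit w x n)"
    and "\<And>n. 0 < w n \<Longrightarrow> \<not> R (w n - 1) (up.orbit w x n)"
proof -
  have digit: "digit m \<beta> P y \<le> m"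
      "digit m \<beta> P y < m \<longrightarrow> R (digit m \<beta> P y) y"
      "0 < digit m \<beta> P y \<longrightarrow> \<not> R (digit m \<beta> P y - 1) y"
    if y: "0 \<le> y" "y \<le> M" for y
  proof -
    let ?Q = "\<lambda>k. k \<le> m \<and> (k < m \<longrightarrow> R k y) \<and> (0 < k \<longrightarrow> \<not> R (k - 1) y)"
    have "digit m \<beta> P y = (THE k. k \<le> m \<and> y \<in> P k)"
      using y by (simp add: digit_def M_def)
    also have "\<dots> = The ?Q" using pieces y by (intro arg_cong[where f = The] ext) blast
    finally have "digit m \<beta> P y = The ?Q" .
    moreover have "?Q (The ?Q)"
      by (rule theI'[OF unique_first_index]) (rule mono)
    ultimately show "digit m \<beta> P y \<le> m"
      "digit m \<beta> P y < m \<longrightarrow> R (digit m \<beta> P y) y"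
      "0 < digit m \<beta> P y \<longrightarrow> \<not> R (digit m \<beta> P y - 1) y" by simp_all
  qed
  have invariant: "0 \<le> piecewise_map m \<beta> P y \<and> piecewise_map m \<beta> P y \<le> M"
    if y: "0 \<le> y" "y \<le> M" for y
  proof -
    define k where "k = digit m \<beta> P y"
    have k: "k \<le> m" "k < m \<longrightarrow> R k y" "0 < k \<longrightarrow> \<not> R (k - 1) y"
      using digit[OF y] by (simp_all add: k_def)
    have "apt \<beta> k \<le> y"
    proof (cases k)
      case 0
      then show ?thesis using y by (simp add: apt_def)
    next
      case (Suc j)
      then show ?thesis using k ge[of j y] by simp
    qed
    moreover have "y \<le> bpt m \<beta> k"
      using k le[of k y] y bpt_top by (cases "k = m") auto
    ultimately show ?thesis
      using base_gt_1[OF k(1)]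
      by (simp add: piecewise_map_def k_def[symmetric] T_def apt_def bpt_eq[OF k(1)]
          pos_divide_le_eq pos_le_divide_eq mult.commute)
  qed
  have orbit: "up.orbit w x n = (piecewise_map m \<beta> P ^^ n) x" for n
  proof (induction n)
    case (Suc n)
    have "w n = digit m \<beta> P ((piecewise_map m \<beta> P ^^ n) x)" by (simp add: w_def digit_sequence_def)
    then have "up.orbit w x (Suc n) = piecewise_map m \<beta> P ((piecewise_map m \<beta> P ^^ n) x)"
      by (simp only: up.orbit.simps up_branch Suc.IH
          piecewise_map_def[of m \<beta> P "(piecewise_map m \<beta> P ^^ n) x"])
    then show ?case by simp
  qed simp
  have range: "0 \<le> up.orbit w x n \<and> up.orbit w x n \<le> M" for n
    unfolding orbit by (induction n) (simp_all add: x invariant)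
  have w: "w n = digit m \<beta> P (up.orbit w x n)" for n
    unfolding orbit by (simp add: w_def digit_sequence_def)
  show "up.itinerary w x"
    unfolding up.itinerary_def using range digit(1) w by (metis atLeastAtMost_iff)
  show "R (w n) (up.orbit w x n)" if "w n < m" for n
    using digit(2)[of "up.orbit w x n"] range[of n] that by (simp add: w[symmetric])
  show "\<not> R (w n - 1) (up.orbit w x n)" if "0 < w n" for n
    using digit(3)[of "up.orbit w x n"] range[of n] that by (simp add: w[symmetric])
qed

lemma greedy_is_greedy_itinerary:
  assumes "0 \<le> x" "x \<le> M"
  shows "up.greedy_itinerary (greedy m \<beta> x) x"
proof -
  have pieces: "y \<in> greedy_piece m \<beta> k \<longleftrightarrow>
      (k < m \<longrightarrow> y < apt \<beta> (Suc k)) \<and> (0 < k \<longrightarrow> \<not> y < apt \<beta> (Suc (k - 1)))"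
    if "k \<le> m" "0 \<le> y" "y \<le> M" for k y
    using that bpt_top m_pos by (cases k) (auto simp: greedy_piece_def apt_def)
  have mono: "y < apt \<beta> (Suc (Suc k))" if "Suc k < m" "y < apt \<beta> (Suc k)" for k y
    using that apt_step[of "Suc k"] by simp
  have le: "y \<le> bpt m \<beta> k" if "k < m" "y < apt \<beta> (Suc k)" for k y
    using that apt_le_bpt[of k] by simp
  note seq = digit_sequence_itinerary[where R = "\<lambda>k y. y < apt \<beta> (Suc k)",
      OF pieces mono le _ assms, folded greedy_def]
  show ?thesis
    unfolding up.greedy_itinerary_def up_left using seq(1,2) by auto
qed

lemma quasi_greedy_is_quasi_greedy_itinerary:
  assumes "0 \<le> x" "x \<le> M"
  shows "up.quasi_greedy_itinerary (quasi_greedy m \<beta> x) x"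
proof -
  have pieces: "y \<in> quasi_greedy_piece m \<beta> k \<longleftrightarrow>
      (k < m \<longrightarrow> y \<le> apt \<beta> (Suc k)) \<and> (0 < k \<longrightarrow> \<not> y \<le> apt \<beta> (Suc (k - 1)))"
    if "k \<le> m" "0 \<le> y" "y \<le> M" for k y
    using that bpt_top m_pos by (cases k) (auto simp: quasi_greedy_piece_def)
  have mono: "y \<le> apt \<beta> (Suc (Suc k))" if "Suc k < m" "y \<le> apt \<beta> (Suc k)" for k y
    using that apt_step[of "Suc k"] by simp
  have le: "y \<le> bpt m \<beta> k" if "k < m" "y \<le> apt \<beta> (Suc k)" for k y
    using that apt_le_bpt[of k] by simp
  note seq = digit_sequence_itinerary[where R = "\<lambda>k y. y \<le> apt \<beta> (Suc k)",
      OF pieces mono le _ assms, folded quasi_greedy_def]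
  show ?thesis
    unfolding up.quasi_greedy_itinerary_def up_left using seq by (auto simp: not_le)
qed

lemma lazy_is_reflected_greedy_itinerary:
  assumes "0 \<le> x" "x \<le> M"
  shows "up.itinerary (lazy m \<beta> x) x"
    and "down.greedy_itinerary (\<lambda>i. m - lazy m \<beta> x i) (- x)"
proof -
  have pieces: "y \<in> lazy_piece m \<beta> k \<longleftrightarrow>
      (k < m \<longrightarrow> y \<le> bpt m \<beta> k) \<and> (0 < k \<longrightarrow> \<not> y \<le> bpt m \<beta> (k - 1))"
    if "k \<le> m" "0 \<le> y" "y \<le> M" for k y
    using that bpt_top m_pos by (cases "k = m") (auto simp: lazy_piece_def)
  have mono: "y \<le> bpt m \<beta> (Suc k)" if "Suc k < m" "y \<le> bpt m \<beta> k" for k y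
    using that bpt_step[of k] by simp
  have ge: "apt \<beta> (Suc k) \<le> y" if "k < m" "\<not> y \<le> bpt m \<beta> k" for k y
    using that apt_le_bpt[of k] by simp
  note seq = digit_sequence_itinerary[where R = "\<lambda>k y. y \<le> bpt m \<beta> k",
      OF pieces mono _ ge assms, folded lazy_def]
  show "up.itinerary (lazy m \<beta> x) x" by (rule seq(1))
  have digits: "lazy m \<beta> x n \<le> m" for n using seq(1) by (rule up.itineraryD)
  have "bpt m \<beta> (lazy m \<beta> x n - 1) < up.orbit (lazy m \<beta> x) x n" if "0 < lazy m \<beta> x n" for n
    using seq(3) that by (auto simp: not_le)
  then show "down.greedy_itinerary (\<lambda>i. m - lazy m \<beta> x i) (- x)"
    unfolding down.greedy_itinerary_def down_left
    using seq(1) digits by (auto simp: down_itinerary down_orbit)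
qed

lemma quasi_lazy_is_reflected_quasi_greedy_itinerary:
  assumes "0 \<le> x" "x \<le> M"
  shows "up.itinerary (quasi_lazy m \<beta> x) x"
    and "down.quasi_greedy_itinerary (\<lambda>i. m - quasi_lazy m \<beta> x i) (- x)"
proof -
  have pieces: "y \<in> quasi_lazy_piece m \<beta> k \<longleftrightarrow>
      (k < m \<longrightarrow> y < bpt m \<beta> k) \<and> (0 < k \<longrightarrow> \<not> y < bpt m \<beta> (k - 1))"
    if "k \<le> m" "0 \<le> y" "y \<le> M" for k y
    using that bpt_top m_pos by (cases "k = m") (auto simp: quasi_lazy_piece_def)
  have mono: "y < bpt m \<beta> (Suc k)" if "Suc k < m" "y < bpt m \<beta> k" for k y
    using that bpt_step[of k] by simp
  have ge: "apt \<beta> (Suc k) \<le> y" if "k < m" "\<not> y < bpt m \<beta> k" for k y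
    using that apt_le_bpt[of k] by simp
  note seq = digit_sequence_itinerary[where R = "\<lambda>k y. y < bpt m \<beta> k",
      OF pieces mono less_imp_le ge assms, folded quasi_lazy_def]
  show "up.itinerary (quasi_lazy m \<beta> x) x" by (rule seq(1))
  have digits: "quasi_lazy m \<beta> x n \<le> m" for n using seq(1) by (rule up.itineraryD)
  have "bpt m \<beta> (quasi_lazy m \<beta> x n - 1) \<le> up.orbit (quasi_lazy m \<beta> x) x n"
    if "0 < quasi_lazy m \<beta> x n" for n
    using seq(3) that by (auto simp: not_less)
  then show "down.quasi_greedy_itinerary (\<lambda>i. m - quasi_lazy m \<beta> x i) (- x)"
    unfolding down.quasi_greedy_itinerary_def down_left
    using seq(1,2) digits by (auto simp: down_itinerary down_orbit)
qed

text \<open>If \<open>M < 1\<close>, the points \<open>1\<close> and \<open>M - 1\<close> are outside the interval, and their digit sequences are those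
of the nearest ends \<open>M\<close> and \<open>0\<close>. This is why the comparison point below is \<open>min 1 M\<close>, and
\<open>min 1 M - M = - max 0 (M - 1)\<close> after reflection.\<close>

lemma digit_sequence_above:
  assumes "M < x"
  shows "digit_sequence m \<beta> P x = (\<lambda>_. m)"
proof -
  have digit: "digit m \<beta> P y = m" if "M < y" for y
    using that M_pos by (simp add: digit_def M_def[symmetric])
  have "M < (piecewise_map m \<beta> P ^^ n) x" for n
  proof (induction n)
    case (Suc n)
    then have "\<beta> m * M < \<beta> m * (piecewise_map m \<beta> P ^^ n) x" using base_gt_1[of m] by simp
    then show ?case using Suc M_fixed
      by (simp add: piecewise_map_def[where x = "(piecewise_map m \<beta> P ^^ n) x"] digit T_def)
  qed (simp add: assms)
  then show ?thesis by (simp add: digit_sequence_def digit)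
qed

lemma digit_sequence_below:
  assumes "x < 0"
  shows "digit_sequence m \<beta> P x = (\<lambda>_. 0)"
proof -
  have digit: "digit m \<beta> P y = 0" if "y < 0" for y
    using that by (simp add: digit_def)
  have "(piecewise_map m \<beta> P ^^ n) x < 0" for n
  proof (induction n)
    case (Suc n)
    then show ?case using base_gt_1[of 0]
      by (simp add: piecewise_map_def[where x = "(piecewise_map m \<beta> P ^^ n) x"] digit T_def
          mult_pos_neg)
  qed (simp add: assms)
  then show ?thesis by (simp add: digit_sequence_def digit)
qed

lemma quasi_greedy_of_1:
  "up.quasi_greedy_itinerary (quasi_greedy m \<beta> 1) (min 1 M)"
proof (cases "1 \<le> M")
  case True
  then show ?thesis using quasi_greedy_is_quasi_greedy_itinerary[of 1] by simp
next
  case False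
  have orbit: "up.orbit (\<lambda>_. m) M n = M" for n
    by (induction n) (simp_all add: up.branch_def M_fixed)
  have "apt \<beta> m < bpt m \<beta> m"
    using base_gt_1[of m] M_pos by (simp add: bpt_eq apt_def divide_strict_right_mono)
  then have "apt \<beta> m < M" by (simp only: bpt_top)
  then have "up.quasi_greedy_itinerary (\<lambda>_. m) M"
    using M_pos by (simp add: up.quasi_greedy_itinerary_def up.itinerary_def orbit up_left)
  then show ?thesis using False digit_sequence_above[of 1] by (simp add: quasi_greedy_def)
qed

lemma reflected_quasi_lazy:
  "down.quasi_greedy_itinerary (\<lambda>i. m - quasi_lazy m \<beta> (M - 1) i) (min 1 M - M)"
proof (cases "1 \<le> M")
  case True
  then show ?thesis using quasi_lazy_is_reflected_quasi_greedy_itinerary(2)[of "M - 1"] by simp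
next
  case False
  have orbit: "down.orbit (\<lambda>_. m) 0 n = 0" for n
    by (induction n) (simp_all add: down.branch_def)
  have "0 < bpt m \<beta> 0"
    using base_gt_1[of 0] M_pos by (simp add: bpt_eq)
  then have "down.quasi_greedy_itinerary (\<lambda>_. m) 0"
    using M_pos by (simp add: down.quasi_greedy_itinerary_def down.itinerary_def orbit down_left)
  then show ?thesis using False digit_sequence_below[of "M - 1"] by (simp add: quasi_lazy_def)
qed

section \<open>The lexicographic criteria\<close>

text \<open>The condition \<open>apt \<beta> (k + 1) \<le> bpt m \<beta> k\<close>, cleared of either denominator. It gives the part of
the threshold bounds that concerns the end of the interval when \<open>M < 1\<close>.\<close>

lemma overlap_bounds:
  assumes "k < m"
  shows "real (Suc k) \<le> \<beta> (Suc k) * bpt m \<beta> k" "\<beta> k * apt \<beta> (Suc k) \<le> real k + M"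
proof -
  have "apt \<beta> (Suc k) \<le> bpt m \<beta> k" using assms by (rule apt_le_bpt)
  then show "real (Suc k) \<le> \<beta> (Suc k) * bpt m \<beta> k" "\<beta> k * apt \<beta> (Suc k) \<le> real k + M"
    using base_gt_1[of k] base_gt_1[of "Suc k"] assms
    by (simp_all add: apt_def bpt_eq pos_divide_le_eq pos_le_divide_eq mult.commute)
qed

text \<open>Both bounds compare two neighbouring bases: \<open>\<beta> k * (k + 1) / \<beta> (k + 1) - k \<le> 1\<close> for the given
system, and \<open>\<beta> (j + 1) * (j + M) / \<beta> j - (j + 1) \<ge> M - 1\<close> with \<open>j = m - k - 1\<close> for the reflected one.
Reflection reverses the order of the bases and the sign of the inequality, so the same monotonicity
serves both.\<close>

lemma branch_at_threshold_mono:
  assumes mono: "mono_on {0..m} \<beta>" and k: "k < m"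
  shows "up.branch k (up.left (Suc k)) \<le> min 1 M"
    and "down.branch k (down.left (Suc k)) \<le> min 1 M - M"
proof -
  have "\<beta> k \<le> \<beta> (Suc k)" using mono k by (auto simp: monotone_on_def)
  then have "\<beta> k * real (Suc k) \<le> \<beta> (Suc k) * real (Suc k)" by (rule mult_right_mono) simp
  then have "\<beta> k * apt \<beta> (Suc k) \<le> real (Suc k)"
    using base_gt_1[of "Suc k"] k by (simp add: apt_def pos_divide_le_eq mult.commute)
  then show "up.branch k (up.left (Suc k)) \<le> min 1 M"
    using overlap_bounds(2)[OF k] by (simp add: up.branch_def up_left)
next
  define j where "j = m - Suc k"
  have j: "j < m" "m - k = Suc j" using k by (auto simp: j_def)
  have "\<beta> j \<le> \<beta> (Suc j)" using mono j by (auto simp: monotone_on_def)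
  then have "\<beta> j * (real j + M) \<le> \<beta> (Suc j) * (real j + M)"
    using M_pos by (intro mult_right_mono) auto
  then have "real j + M \<le> \<beta> (Suc j) * bpt m \<beta> j"
    using base_gt_1[of j] j by (simp add: bpt_eq pos_le_divide_eq mult.commute)
  then show "down.branch k (down.left (Suc k)) \<le> min 1 M - M"
    using overlap_bounds(1)[OF j(1)] by (simp add: down.branch_def down_left j j_def[symmetric])
qed

lemma branch_at_threshold_antimono:
  assumes antimono: "antimono_on {0..m} \<beta>" and k: "k < m"
  shows "min 1 M \<le> up.branch k (up.left (Suc k))"
    and "min 1 M - M \<le> down.branch k (down.left (Suc k))"
proof -
  have "\<beta> (Suc k) \<le> \<beta> k" using antimono k by (auto simp: monotone_on_def)
  then have "\<beta> (Suc k) * real (Suc k) \<le> \<beta> k * real (Suc k)" by (rule mult_right_mono) simp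
  then have "real (Suc k) \<le> \<beta> k * apt \<beta> (Suc k)"
    using base_gt_1[of "Suc k"] k by (simp add: apt_def pos_le_divide_eq mult.commute)
  then show "min 1 M \<le> up.branch k (up.left (Suc k))"
    by (simp add: up.branch_def up_left)
next
  define j where "j = m - Suc k"
  have j: "j < m" "m - k = Suc j" using k by (auto simp: j_def)
  have "\<beta> (Suc j) \<le> \<beta> j" using antimono j by (auto simp: monotone_on_def)
  then have "\<beta> (Suc j) * (real j + M) \<le> \<beta> j * (real j + M)"
    using M_pos by (intro mult_right_mono) auto
  then have "\<beta> (Suc j) * bpt m \<beta> j \<le> real j + M"
    using base_gt_1[of j] j by (simp add: bpt_eq pos_divide_le_eq mult.commute)
  then show "min 1 M - M \<le> down.branch k (down.left (Suc k))"
    by (simp add: down.branch_def down_left j j_def[symmetric])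
qed

lemma upper_condition_iff:
  "upper_condition m \<beta> w \<longleftrightarrow>
     (\<forall>n. w n < m \<longrightarrow> less_fun (shift (Suc n) w) (quasi_greedy m \<beta> 1))"
  unfolding upper_condition_def all_ge_1_iff by simp

text \<open>Complementing digits reverses the lexicographic order and exchanges the digits \<open>0\<close> and \<open>m\<close>, so the
lower condition has the form of an upper condition for the reflected system.\<close>

lemma lower_condition_iff:
  assumes w: "\<And>i. w i \<le> m"
  shows "lower_condition m \<beta> w \<longleftrightarrow>
     (\<forall>n. m - w n < m \<longrightarrow>
        less_fun (shift (Suc n) (\<lambda>i. m - w i)) (\<lambda>i. m - quasi_lazy m \<beta> (M - 1) i))"
proof -
  have digits: "quasi_lazy m \<beta> (M - 1) i \<le> m" for i
  proof (cases "1 \<le> M")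
    case True
    then show ?thesis
      using quasi_lazy_is_reflected_quasi_greedy_itinerary(1)[of "M - 1"] up.itineraryD(1) by simp
  next
    case False
    then show ?thesis using digit_sequence_below[of "M - 1"] by (simp add: quasi_lazy_def)
  qed
  have "less_fun (shift (Suc n) (\<lambda>i. m - w i)) (\<lambda>i. m - quasi_lazy m \<beta> (M - 1) i) \<longleftrightarrow>
      less_fun (quasi_lazy m \<beta> (M - 1)) (shift (Suc n) w)" for n
    using less_fun_complement[of "shift (Suc n) w" m "quasi_lazy m \<beta> (M - 1)"] w digits
    by (simp add: shift_def)
  moreover have "m - w n < m \<longleftrightarrow> 0 < w n" for n using m_pos w[of n] by auto
  moreover have "lower_condition m \<beta> w \<longleftrightarrow>
     (\<forall>n. 0 < w n \<longrightarrow> less_fun (quasi_lazy m \<beta> (M - 1)) (shift (Suc n) w))"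
    unfolding lower_condition_def all_ge_1_iff M_def by simp
  ultimately show ?thesis by simp
qed

lemma eq_greedy_iff:
  assumes "up.itinerary w x"
  shows "w = greedy m \<beta> x \<longleftrightarrow> up.greedy_itinerary w x"
proof -
  have "up.greedy_itinerary (greedy m \<beta> x) x"
    using up.itineraryD(2,3)[OF assms, of 0] by (intro greedy_is_greedy_itinerary) auto
  then show ?thesis by (metis up.greedy_itinerary_unique)
qed

lemma eq_lazy_iff:
  assumes "up.itinerary w x"
  shows "w = lazy m \<beta> x \<longleftrightarrow> down.greedy_itinerary (\<lambda>i. m - w i) (- x)"
proof
  have x: "0 \<le> x" "x \<le> M" using up.itineraryD(2,3)[OF assms, of 0] by simp_all
  note lazy = lazy_is_reflected_greedy_itinerary(2)[OF x]
  then show "down.greedy_itinerary (\<lambda>i. m - w i) (- x)" if "w = lazy m \<beta> x"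
    using that by simp
  assume "down.greedy_itinerary (\<lambda>i. m - w i) (- x)"
  then have "(\<lambda>i. m - w i) = (\<lambda>i. m - lazy m \<beta> x i)"
    using lazy by (rule down.greedy_itinerary_unique)
  then show "w = lazy m \<beta> x"
    using complement_inject[of w m "lazy m \<beta> x"] up.itineraryD(1) assms
      lazy_is_reflected_greedy_itinerary(1)[OF x] by blast
qed

text \<open>Every expansion lies lexicographically between the lazy and the greedy one; if these coincide,
nothing else is left.\<close>

lemma unique_iff_greedy_and_lazy:
  assumes w: "up.itinerary w x"
  shows "is_unique_expansion m \<beta> w x \<longleftrightarrow> w = greedy m \<beta> x \<and> w = lazy m \<beta> x"
proof
  assume unique: "is_unique_expansion m \<beta> w x"
  have x: "0 \<le> x" "x \<le> M" using up.itineraryD(2,3)[OF w, of 0] by simp_all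
  have "up.itinerary (greedy m \<beta> x) x" "up.itinerary (lazy m \<beta> x) x"
    using greedy_is_greedy_itinerary[OF x] lazy_is_reflected_greedy_itinerary(1)[OF x]
    by (simp_all add: up.greedy_itinerary_def)
  then show "w = greedy m \<beta> x \<and> w = lazy m \<beta> x"
    using unique unfolding is_unique_expansion_def is_expansion_iff_itinerary by metis
next
  assume eq: "w = greedy m \<beta> x \<and> w = lazy m \<beta> x"
  have "v = w" if v: "up.itinerary v x" for v
  proof (rule ccontr)
    assume "v \<noteq> w"
    have digits: "w i \<le> m" "v i \<le> m" for i using w v by (auto intro: up.itineraryD)
    have "up.greedy_itinerary w x" using eq eq_greedy_iff[OF w] by blast
    then have "less_fun v w" using up.greedy_itinerary_greatest v \<open>v \<noteq> w\<close> by blast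
    have "down.greedy_itinerary (\<lambda>i. m - w i) (- x)" using eq eq_lazy_iff[OF w] by blast
    moreover have "down.itinerary (\<lambda>i. m - v i) (- x)" using v digits by (simp add: down_itinerary)
    moreover have "(\<lambda>i. m - v i) \<noteq> (\<lambda>i. m - w i)"
      using complement_inject[of v m w] digits \<open>v \<noteq> w\<close> by blast
    ultimately have "less_fun (\<lambda>i. m - v i) (\<lambda>i. m - w i)"
      using down.greedy_itinerary_greatest by blast
    then have "less_fun w v" using digits by (simp add: less_fun_complement)
    then show False using \<open>less_fun v w\<close> less_fun_asym by blast
  qed
  then show "is_unique_expansion m \<beta> w x"
    using w unfolding is_unique_expansion_def is_expansion_iff_itinerary by blast
qed

end

theorem corollary1p5:
  fixes m :: nat and \<beta> :: "nat \<Rightarrow> real" and x :: real and w :: "nat \<Rightarrow> nat"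
  assumes "m \<ge> 1"
    and "\<beta> \<in> D m"
    and "x \<in> {0 .. real m / (\<beta> m - 1)}"
    and "is_expansion m \<beta> w x"
  shows
    "(mono_on {0..m} \<beta> \<longrightarrow> w = greedy m \<beta> x \<longrightarrow> upper_condition m \<beta> w) \<and>
     (antimono_on {0..m} \<beta> \<longrightarrow> upper_condition m \<beta> w \<longrightarrow> w = greedy m \<beta> x) \<and>
     (mono_on {0..m} \<beta> \<longrightarrow> w = lazy m \<beta> x \<longrightarrow> lower_condition m \<beta> w) \<and>
     (antimono_on {0..m} \<beta> \<longrightarrow> lower_condition m \<beta> w \<longrightarrow> w = lazy m \<beta> x) \<and>
     (mono_on {0..m} \<beta> \<longrightarrow> is_unique_expansion m \<beta> w x \<longrightarrow>
        upper_condition m \<beta> w \<and> lower_condition m \<beta> w) \<and>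
     (antimono_on {0..m} \<beta> \<longrightarrow> upper_condition m \<beta> w \<and> lower_condition m \<beta> w \<longrightarrow>
        is_unique_expansion m \<beta> w x)"
proof -
  interpret base_tuple m \<beta>
    using assms by unfold_locales
  have w: "up.itinerary w x" using assms(4) by (simp add: is_expansion_iff_itinerary)
  have digits: "w i \<le> m" for i using w by (rule up.itineraryD)
  have reflected: "down.itinerary (\<lambda>i. m - w i) (- x)" using w digits by (simp add: down_itinerary)
  have greedy_upper: "upper_condition m \<beta> w" if "mono_on {0..m} \<beta>" "w = greedy m \<beta> x"
    unfolding upper_condition_iff
    using up.greedy_imp_lexicographic[OF branch_at_threshold_mono(1) quasi_greedy_of_1]
      that eq_greedy_iff[OF w] by blast
  have upper_greedy: "w = greedy m \<beta> x" if "antimono_on {0..m} \<beta>" "upper_condition m \<beta> w"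
    using up.lexicographic_imp_greedy[OF branch_at_threshold_antimono(1) quasi_greedy_of_1 w]
      that eq_greedy_iff[OF w] by (simp add: upper_condition_iff)
  have lazy_lower: "lower_condition m \<beta> w" if "mono_on {0..m} \<beta>" "w = lazy m \<beta> x"
    unfolding lower_condition_iff[OF digits]
    using down.greedy_imp_lexicographic[OF branch_at_threshold_mono(2) reflected_quasi_lazy]
      that eq_lazy_iff[OF w] by blast
  have lower_lazy: "w = lazy m \<beta> x" if "antimono_on {0..m} \<beta>" "lower_condition m \<beta> w"
    using down.lexicographic_imp_greedy
        [OF branch_at_threshold_antimono(2) reflected_quasi_lazy reflected]
      that eq_lazy_iff[OF w] by (simp add: lower_condition_iff[OF digits])
  have unique: "is_unique_expansion m \<beta> w x \<longleftrightarrow> w = greedy m \<beta> x \<and> w = lazy m \<beta> x"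
    by (rule unique_iff_greedy_and_lazy[OF w])
  show ?thesis using greedy_upper upper_greedy lazy_lower lower_lazy unique by blast
qed

end
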